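(* Let $E,F,G,X$ be Banach spaces over the same scalar field, let $c:E\times F\to G$ be a bounded bilinear map, and let $\mathcal V$ be a closed linear subspace of $\mathcal L(G,X)$. With the notation of the context, $$\big(\mathcal L(E\otimes_{\pi_c}F,\,X)\supseteq\big)\quad (E\otimes_{\pi_c}F)^{\mathcal V}=E^{\mathcal V\odot c_L}\quad\big(\subseteq \mathcal L(E,\mathcal L(F,X))\big)$$ isometrically, where $\varphi_T$ is identified with $S_T$ for $T\in\mathcal V$. That is: every $\varphi_T$ ($T\in\mathcal V$) is a well-defined bounded linear operator from $E\otimes_{\pi_c}F$ to $X$; every $S_T$ ($T\in\mathcal V$) is a bounded linear operator from $E$ to $\mathcal L(F,X)$; the assignment $\varphi_T\mapsto S_T$ is a well-defined linear isometric bijection from $(E\otimes_{\pi_c}F)^{\mathcal V}$ onto $E^{\mathcal V\odot c_L}$; and the inclusions $(E\otimes_{\pi_c}F)^{\mathcal V}\subseteq \mathcal L(E\otimes_{\pi_c}F,X)$ and $E^{\mathcal V\odot c_L}\subseteq\mathcal L(E,\mathcal L(F,X))$ are isometric, the larger spaces carrying their operator norms.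
   Context: For normed spaces $Y,X$, $\mathcal L(Y,X)$ denotes the space of bounded linear operators from $Y$ to $X$ with the operator norm, and $B_Y$ denotes the closed unit ball of $Y$. Let $c:E\times F\to G$ be a bounded bilinear map. Its linearization is the linear map $\hat c:E\otimes F\to G$ on the algebraic tensor product with $\hat c(x\otimes y)=c(x,y)$. Its left linearization is $c_L:E\to\mathcal L(F,G)$, $c_L(x)(y)=c(x,y)$. Product space: $E\otimes_{\pi_c}F$ is the linear subspace $\hat c(E\otimes F)$ of $G$ equipped with the norm $$\pi_c(w)=\inf\Big\{\sum_{i=1}^n\|x_i\|\,\|y_i\| : n\in\mathbb N,\ x_i\in E,\ y_i\in F,\ w=\sum_{i=1}^n c(x_i,y_i)\Big\},\qquad w\in\hat c(E\otimes F).$$ (It is a normed space, not necessarily complete.) Let $\mathcal V$ be a closed linear subspace of $\mathcal L(G,X)$. For $T\in\mathcal V$, the linear map $\varphi_T:E\otimes_{\pi_c}F\to X$ is given by $$\varphi_T\Big(\sum_{i=1}^n c(x_i,y_i)\Big)=\sum_{i=1}^n T(c(x_i,y_i)).$$ The generalized dual space is $(E\otimes_{\pi_c}F)^{\mathcal V}=\{\varphi_T : T\in\mathcal V\}$, endowed with the norm $\|\varphi_T\|=\sup_{x\in B_E,\,y\in B_F}\|T(c(x,y))\|_X$. For $T\in\mathcal V$, the generalized multiplication operator $S_T:E\to\mathcal L(F,X)$ is given by $S_T(x)(y)=T(c_L(x)(y))=T(c(x,y))$. The space of multiplication operators is $E^{\mathcal V\odot c_L}=\{S_T : T\in\mathcal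 V\}$, endowed with the operator norm of $\mathcal L(E,\mathcal L(F,X))$. *)

theory Defs
  imports "HOL-Analysis.Analysis"
begin

text \<open>Scalars range over an arbitrary \<open>'k::real_normed_field\<close>; up to isometric isomorphism the only
  such fields are the reals and the complex numbers, so both cases are covered simultaneously.
  A normed space over \<open>'k\<close> is a type of class \<open>real_normed_vector\<close> with a scalar multiplication \<open>s\<close>
  by \<open>'k\<close> that extends \<open>scaleR\<close>.\<close>

locale normed_space_over = vector_space s
  for s :: "'k::real_normed_field \<Rightarrow> 'a::real_normed_vector \<Rightarrow> 'a" +
  assumes norm_scale: "norm (s k x) = norm k * norm x"
    and scale_of_real: "s (of_real r) x = r *\<^sub>R x"

lemma normed_space_over_real:
  "normed_space_over (scaleR :: real \<Rightarrow> 'a::real_normed_vector \<Rightarrow> 'a)"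
  by unfold_locales (auto simp: algebra_simps)

lemma normed_space_over_complex:
  "normed_space_over ((*) :: complex \<Rightarrow> complex \<Rightarrow> complex)"
  by unfold_locales (auto simp: algebra_simps norm_mult scaleR_conv_of_real)

definition bounded_bilinear_over ::
  "('k::real_normed_field \<Rightarrow> 'e::real_normed_vector \<Rightarrow> 'e) \<Rightarrow>
   ('k \<Rightarrow> 'f::real_normed_vector \<Rightarrow> 'f) \<Rightarrow> ('k \<Rightarrow> 'g::real_normed_vector \<Rightarrow> 'g) \<Rightarrow>
   ('e \<Rightarrow> 'f \<Rightarrow> 'g) \<Rightarrow> bool"
  where "bounded_bilinear_over sE sF sG c \<longleftrightarrow>
    bounded_bilinear c \<and>
    (\<forall>x. Vector_Spaces.linear sF sG (\<lambda>y. c x y)) \<and>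
    (\<forall>y. Vector_Spaces.linear sE sG (\<lambda>x. c x y))"

text \<open>The type \<open>'a \<Rightarrow>\<^sub>L 'b\<close> consists of the real-linear bounded operators. The space of bounded
  \<open>'k\<close>-linear operators is the following subset, with the same norm and pointwise scalar
  multiplication \<open>scale_blinfun\<close>.\<close>

definition bounded_ops ::
  "('k::real_normed_field \<Rightarrow> 'a::real_normed_vector \<Rightarrow> 'a) \<Rightarrow>
   ('k \<Rightarrow> 'b::real_normed_vector \<Rightarrow> 'b) \<Rightarrow> ('a \<Rightarrow>\<^sub>L 'b) set"
  where "bounded_ops sA sB = {T. Vector_Spaces.linear sA sB (blinfun_apply T)}"

definition scale_blinfun ::
  "('k::real_normed_field \<Rightarrow> 'b::real_normed_vector \<Rightarrow> 'b) \<Rightarrow>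
   'k \<Rightarrow> ('a::real_normed_vector \<Rightarrow>\<^sub>L 'b) \<Rightarrow> ('a \<Rightarrow>\<^sub>L 'b)"
  where "scale_blinfun s k T = Blinfun (\<lambda>y. s k (blinfun_apply T y))"

text \<open>\<open>\<L>(E, \<L>(F, X))\<close>, with all operators linear over \<open>'k\<close>.\<close>

definition bounded_ops2 ::
  "('k::real_normed_field \<Rightarrow> 'e::real_normed_vector \<Rightarrow> 'e) \<Rightarrow>
   ('k \<Rightarrow> 'f::real_normed_vector \<Rightarrow> 'f) \<Rightarrow> ('k \<Rightarrow> 'x::real_normed_vector \<Rightarrow> 'x) \<Rightarrow>
   ('e \<Rightarrow>\<^sub>L 'f \<Rightarrow>\<^sub>L 'x) set"
  where "bounded_ops2 sE sF sX =
    {S \<in> bounded_ops sE (scale_blinfun sX). range (blinfun_apply S) \<subseteq> bounded_ops sF sX}"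

lemma (in normed_space_over) bounded_linear_scale: "bounded_linear (s k)"
proof (rule bounded_linear_intro[where K = "norm k"])
  show "s k (x + y) = s k x + s k y" for x y by (rule scale_right_distrib)
  show "s k (r *\<^sub>R x) = r *\<^sub>R s k x" for r x
    by (metis scale_left_commute scale_of_real)
  show "norm (s k x) \<le> norm x * norm k" for x by (simp add: norm_scale)
qed

lemma (in normed_space_over) blinfun_apply_scale_blinfun:
  "blinfun_apply (scale_blinfun s k T) y = s k (blinfun_apply T y)"
proof -
  have "bounded_linear (\<lambda>y. s k (blinfun_apply T y))"
    by (rule bounded_linear_compose[OF bounded_linear_scale blinfun.bounded_linear_right])
  then show ?thesis
    by (simp add: scale_blinfun_def bounded_linear_Blinfun_apply)
qed

lemma (in normed_space_over) normed_space_over_scale_blinfun: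
  "normed_space_over (scale_blinfun s :: 'k \<Rightarrow> ('c::real_normed_vector \<Rightarrow>\<^sub>L 'a) \<Rightarrow> _)"
proof unfold_locales
  fix k l :: 'k and r :: real and T U :: "'c \<Rightarrow>\<^sub>L 'a"
  show "scale_blinfun s k (T + U) = scale_blinfun s k T + scale_blinfun s k U"
    "scale_blinfun s (k + l) T = scale_blinfun s k T + scale_blinfun s l T"
    "scale_blinfun s k (scale_blinfun s l T) = scale_blinfun s (k * l) T"
    "scale_blinfun s 1 T = T"
    "scale_blinfun s (of_real r) T = r *\<^sub>R T"
    by (auto intro!: blinfun_eqI simp: blinfun_apply_scale_blinfun blinfun.add_left
        blinfun.scaleR_left scale_right_distrib scale_left_distrib scale_of_real)
  have le: "norm (scale_blinfun s j A) \<le> norm j * norm A" for j and A :: "'c \<Rightarrow>\<^sub>L 'a"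
    by (rule norm_blinfun_bound)
      (simp_all add: blinfun_apply_scale_blinfun norm_scale mult.assoc norm_blinfun mult_left_mono)
  show "norm (scale_blinfun s k T) = norm k * norm T"
  proof (cases "k = 0")
    case True
    then show ?thesis using le[of k T] by simp
  next
    case False
    have "T = scale_blinfun s (inverse k) (scale_blinfun s k T)"
      using False by (auto intro!: blinfun_eqI simp: blinfun_apply_scale_blinfun)
    then have "norm T \<le> norm (inverse k) * norm (scale_blinfun s k T)"
      by (metis le)
    with False have "norm k * norm T \<le> norm (scale_blinfun s k T)"
      by (simp add: norm_divide field_simps)
    with le[of k T] show ?thesis by simp
  qed
qed


text \<open>The product space of a bounded bilinear map \<open>c\<close>. Every element of the algebraic tensor product is a
  finite sum of elementary tensors \<open>x \<otimes> y\<close> and the linearization of \<open>c\<close> maps \<open>x \<otimes> y\<close> to \<open>c x y\<close>, so the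
  range of the linearization is the set below; see \<open>range_linearization\<close>, where \<open>t\<close> plays the role of
  the canonical map of the tensor product.\<close>

definition prod_space :: "('e \<Rightarrow> 'f \<Rightarrow> 'g::comm_monoid_add) \<Rightarrow> 'g set"
  where "prod_space c = {w. \<exists>(n::nat) x y. w = (\<Sum>i<n. c (x i) (y i))}"

definition prod_norm ::
  "('e::real_normed_vector \<Rightarrow> 'f::real_normed_vector \<Rightarrow> 'g::comm_monoid_add) \<Rightarrow> 'g \<Rightarrow> real"
  where "prod_norm c w =
    Inf {r. \<exists>(n::nat) x y. w = (\<Sum>i<n. c (x i) (y i)) \<and> r = (\<Sum>i<n. norm (x i) * norm (y i))}"

lemma sum_append:
  fixes f :: "'e \<Rightarrow> 'f \<Rightarrow> 'g::comm_monoid_add" and n m :: nat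
  shows "(\<Sum>i<n + m. f (if i < n then x i else x' (i - n)) (if i < n then y i else y' (i - n)))
    = (\<Sum>i<n. f (x i) (y i)) + (\<Sum>i<m. f (x' i) (y' i))"
proof -
  have "(\<Sum>i<n + m. g i) = (\<Sum>i<n. g i) + (\<Sum>i<m. g (n + i))" for g :: "nat \<Rightarrow> 'g"
    by (induction m) (auto simp: add.assoc)
  then show ?thesis by simp
qed

lemma subspace_prod_space:
  assumes "bounded_bilinear_over sE sF sG c"
  shows "module.subspace sG (prod_space c)"
proof -
  have lin: "Vector_Spaces.linear sE sG (\<lambda>x. c x y)" for y
    using assms by (simp add: bounded_bilinear_over_def)
  interpret L: Vector_Spaces.linear sE sG "\<lambda>x. c x y" for y by (rule lin)
  show ?thesis
  proof (rule L.vs2.subspaceI)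
    show "0 \<in> prod_space c"
      unfolding prod_space_def mem_Collect_eq by (intro exI[of _ 0]) simp
  next
    fix u v assume "u \<in> prod_space c" "v \<in> prod_space c"
    then obtain n m :: nat and x y x' y'
      where "u = (\<Sum>i<n. c (x i) (y i))" "v = (\<Sum>i<m. c (x' i) (y' i))"
      unfolding prod_space_def by blast
    then have "u + v = (\<Sum>i<n + m. c (if i < n then x i else x' (i - n))
        (if i < n then y i else y' (i - n)))"
      by (simp only: sum_append)
    then show "u + v \<in> prod_space c"
      unfolding prod_space_def mem_Collect_eq
      by (intro exI[of _ "n + m"] exI[of _ "\<lambda>i. if i < n then x i else x' (i - n)"]
          exI[of _ "\<lambda>i. if i < n then y i else y' (i - n)"])
  next
    fix k u assume "u \<in> prod_space c"
    then obtain n :: nat and x y where "u = (\<Sum>i<n. c (x i) (y i))"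
      unfolding prod_space_def by blast
    then have "sG k u = (\<Sum>i<n. c (sE k (x i)) (y i))"
      by (simp add: L.vs2.scale_sum_right L.scale)
    then show "sG k u \<in> prod_space c"
      unfolding prod_space_def mem_Collect_eq
      by (intro exI[of _ n] exI[of _ "\<lambda>i. sE k (x i)"] exI[of _ y])
  qed
qed

lemma range_linearization:
  assumes c: "bounded_bilinear_over sE sF sG c"
    and spans: "module.span sV (range (\<lambda>(x, y). t x y)) = UNIV"
    and h: "Vector_Spaces.linear sV sG h"
    and ht: "\<And>x y. h (t x y) = c x y"
  shows "range h = prod_space c"
proof -
  interpret H: Vector_Spaces.linear sV sG h by (rule h)
  have sub: "H.vs2.subspace (prod_space c)"
    by (rule subspace_prod_space[OF c])
  have rng: "range h = H.vs2.span (range (\<lambda>(x, y). c x y))"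
    using H.span_image[of "range (\<lambda>(x, y). t x y)"] spans
    by (simp add: image_image case_prod_unfold ht)
  have "range (\<lambda>(x, y). c x y) \<subseteq> prod_space c"
  proof clarify
    fix x y
    have "c x y = (\<Sum>i<Suc 0. c ((\<lambda>_. x) i) ((\<lambda>_. y) i))" by simp
    then show "c x y \<in> prod_space c"
      unfolding prod_space_def mem_Collect_eq by (intro exI)
  qed
  then have "range h \<subseteq> prod_space c"
    unfolding rng by (rule H.vs2.span_minimal[OF _ sub])
  moreover have "prod_space c \<subseteq> range h"
    unfolding rng prod_space_def
    by (force intro!: H.vs2.span_sum intro: H.vs2.span_base)
  ultimately show ?thesis by blast
qed

lemma prod_norm_bdd_below:
  "bdd_below {r. \<exists>(n::nat) x y. w = (\<Sum>i<n. c (x i) (y i)) \<and>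
    r = (\<Sum>i<n. norm (x i) * norm (y i))}"
  by (rule bdd_belowI[of _ 0]) (auto intro!: sum_nonneg)

lemma prod_norm_upper:
  fixes n :: nat
  assumes "w = (\<Sum>i<n. c (x i) (y i))"
  shows "prod_norm c w \<le> (\<Sum>i<n. norm (x i) * norm (y i))"
  unfolding prod_norm_def by (rule cInf_lower[OF _ prod_norm_bdd_below]) (use assms in blast)

lemma prod_norm_greatest:
  assumes "w \<in> prod_space c"
    and "\<And>(n::nat) x y. w = (\<Sum>i<n. c (x i) (y i)) \<Longrightarrow> b \<le> (\<Sum>i<n. norm (x i) * norm (y i))"
  shows "b \<le> prod_norm c w"
  unfolding prod_norm_def
  by (rule cInf_greatest) (use assms in \<open>auto simp: prod_space_def\<close>)

lemma prod_norm_is_norm: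
  assumes E: "normed_space_over sE" and G: "normed_space_over sG"
    and c: "bounded_bilinear_over sE sF sG c"
    and u: "u \<in> prod_space c" and v: "v \<in> prod_space c"
  shows "0 \<le> prod_norm c u"
    and "prod_norm c u = 0 \<longleftrightarrow> u = 0"
    and "prod_norm c (u + v) \<le> prod_norm c u + prod_norm c v"
    and "prod_norm c (sG k u) = norm k * prod_norm c u"
proof -
  interpret E: normed_space_over sE by fact
  interpret G: normed_space_over sG by fact
  interpret B: bounded_bilinear c using c by (simp add: bounded_bilinear_over_def)
  have lin: "Vector_Spaces.linear sE sG (\<lambda>x. c x y)" for y
    using c by (simp add: bounded_bilinear_over_def)
  interpret L: Vector_Spaces.linear sE sG "\<lambda>x. c x y" for y by (rule lin)
  have closed: "sG k w \<in> prod_space c" if "w \<in> prod_space c" for k w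
    using subspace_prod_space[OF c] that by (rule G.subspace_scale)
  show nonneg: "0 \<le> prod_norm c u"
    by (rule prod_norm_greatest[OF u]) (auto intro!: sum_nonneg)
  obtain K where K: "K > 0" "\<And>x y. norm (c x y) \<le> norm x * norm y * K"
    using B.pos_bounded by blast
  have "norm u / K \<le> prod_norm c u"
  proof (rule prod_norm_greatest[OF u])
    fix n :: nat and x y assume "u = (\<Sum>i<n. c (x i) (y i))"
    then have "norm u \<le> (\<Sum>i<n. norm (x i) * norm (y i) * K)"
      by (auto intro!: sum_norm_le K)
    then have "norm u \<le> (\<Sum>i<n. norm (x i) * norm (y i)) * K"
      by (simp only: sum_distrib_right)
    with K(1) show "norm u / K \<le> (\<Sum>i<n. norm (x i) * norm (y i))"
      by (simp only: pos_divide_le_eq)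
  qed
  moreover have zero: "prod_norm c 0 \<le> 0"
    using prod_norm_upper[where n = 0 and w = 0 and c = c] by simp
  ultimately show "prod_norm c u = 0 \<longleftrightarrow> u = 0"
    using nonneg K(1) by (auto simp: field_simps)
  have "prod_norm c (u + v) - prod_norm c u \<le> prod_norm c v"
  proof (rule prod_norm_greatest[OF v])
    fix m :: nat and x' y' assume v': "v = (\<Sum>i<m. c (x' i) (y' i))"
    have "prod_norm c (u + v) - (\<Sum>i<m. norm (x' i) * norm (y' i)) \<le> prod_norm c u"
    proof (rule prod_norm_greatest[OF u])
      fix n :: nat and x y assume u': "u = (\<Sum>i<n. c (x i) (y i))"
      have "u + v = (\<Sum>i<n + m. c (if i < n then x i else x' (i - n))
          (if i < n then y i else y' (i - n)))"
        unfolding u' v' by (rule sum_append[symmetric])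
      from prod_norm_upper[where x = "\<lambda>i. if i < n then x i else x' (i - n)"
          and y = "\<lambda>i. if i < n then y i else y' (i - n)", OF this]
      show "prod_norm c (u + v) - (\<Sum>i<m. norm (x' i) * norm (y' i))
          \<le> (\<Sum>i<n. norm (x i) * norm (y i))"
        unfolding sum_append[of "\<lambda>x y. norm x * norm y"] by simp
    qed
    then show "prod_norm c (u + v) - prod_norm c u \<le> (\<Sum>i<m. norm (x' i) * norm (y' i))"
      by simp
  qed
  then show "prod_norm c (u + v) \<le> prod_norm c u + prod_norm c v" by simp
  have le: "prod_norm c (sG j w) \<le> norm j * prod_norm c w"
    if w: "w \<in> prod_space c" and j: "j \<noteq> 0" for j w
  proof -
    have "prod_norm c (sG j w) / norm j \<le> prod_norm c w"
    proof (rule prod_norm_greatest[OF w])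
      fix n :: nat and x y assume w': "w = (\<Sum>i<n. c (x i) (y i))"
      have "sG j w = (\<Sum>i<n. c (sE j (x i)) (y i))"
        unfolding w' by (simp add: G.scale_sum_right L.scale)
      from prod_norm_upper[where x = "\<lambda>i. sE j (x i)" and y = y, OF this]
      have "prod_norm c (sG j w) \<le> norm j * (\<Sum>i<n. norm (x i) * norm (y i))"
        by (simp only: E.norm_scale mult.assoc sum_distrib_left)
      with j show "prod_norm c (sG j w) / norm j \<le> (\<Sum>i<n. norm (x i) * norm (y i))"
        by (simp add: pos_divide_le_eq mult.commute)
    qed
    with j show ?thesis by (simp add: field_simps)
  qed
  show "prod_norm c (sG k u) = norm k * prod_norm c u"
  proof (cases "k = 0")
    case True
    have "0 \<le> prod_norm c 0"
      by (rule prod_norm_greatest[of 0])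
        (use closed[OF u, of 0] in \<open>auto intro!: sum_nonneg\<close>)
    with True zero show ?thesis by simp
  next
    case False
    have "prod_norm c u \<le> norm (inverse k) * prod_norm c (sG k u)"
      using le[OF closed[OF u], of "inverse k" k] False by simp
    with False have "norm k * prod_norm c u \<le> prod_norm c (sG k u)"
      by (simp add: norm_divide field_simps)
    with le[OF u False] show ?thesis by simp
  qed
qed


text \<open>Bounded \<open>'k\<close>-linear operators from the product space to \<open>X\<close>, as functions that are
  \<open>undefined\<close> outside \<open>prod_space c\<close>, with their operator norm and pointwise operations.\<close>

definition prod_ops ::
  "('k::real_normed_field \<Rightarrow> 'g::real_normed_vector \<Rightarrow> 'g) \<Rightarrow>
   ('k \<Rightarrow> 'x::real_normed_vector \<Rightarrow> 'x) \<Rightarrow>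
   ('e::real_normed_vector \<Rightarrow> 'f::real_normed_vector \<Rightarrow> 'g) \<Rightarrow> ('g \<Rightarrow> 'x) set"
  where "prod_ops sG sX c = {\<phi> \<in> extensional (prod_space c).
    (\<forall>u\<in>prod_space c. \<forall>v\<in>prod_space c. \<phi> (u + v) = \<phi> u + \<phi> v) \<and>
    (\<forall>k. \<forall>u\<in>prod_space c. \<phi> (sG k u) = sX k (\<phi> u)) \<and>
    (\<exists>B. \<forall>u\<in>prod_space c. norm (\<phi> u) \<le> B * prod_norm c u)}"

definition prod_opnorm ::
  "('e::real_normed_vector \<Rightarrow> 'f::real_normed_vector \<Rightarrow> 'g::real_normed_vector) \<Rightarrow>
   ('g \<Rightarrow> 'x::real_normed_vector) \<Rightarrow> real"
  where "prod_opnorm c \<phi> = (SUP u\<in>{u \<in> prod_space c. prod_norm c u \<le> 1}. norm (\<phi> u))"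

definition prod_op_add ::
  "('e \<Rightarrow> 'f \<Rightarrow> 'g::comm_monoid_add) \<Rightarrow> ('g \<Rightarrow> 'x::plus) \<Rightarrow> ('g \<Rightarrow> 'x) \<Rightarrow> ('g \<Rightarrow> 'x)"
  where "prod_op_add c \<phi> \<psi> = (\<lambda>u\<in>prod_space c. \<phi> u + \<psi> u)"

definition prod_op_scale ::
  "('k \<Rightarrow> 'x \<Rightarrow> 'x) \<Rightarrow> ('e \<Rightarrow> 'f \<Rightarrow> 'g::comm_monoid_add) \<Rightarrow> 'k \<Rightarrow> ('g \<Rightarrow> 'x) \<Rightarrow> ('g \<Rightarrow> 'x)"
  where "prod_op_scale sX c k \<phi> = (\<lambda>u\<in>prod_space c. sX k (\<phi> u))"


text \<open>The map \<open>\<phi>\<^sub>T\<close>: its value at \<open>w\<close> is the sum of the \<open>T (c (x i) (y i))\<close> for any representation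
  of \<open>w\<close>. Independence of the representation is not built in.\<close>

definition dual_op ::
  "('e \<Rightarrow> 'f \<Rightarrow> 'g::real_normed_vector) \<Rightarrow> ('g \<Rightarrow>\<^sub>L 'x::real_normed_vector) \<Rightarrow> ('g \<Rightarrow> 'x)"
  where "dual_op c T = (\<lambda>w\<in>prod_space c. THE z. \<exists>(n::nat) x y.
    w = (\<Sum>i<n. c (x i) (y i)) \<and> z = (\<Sum>i<n. blinfun_apply T (c (x i) (y i))))"

definition gen_dual ::
  "('e \<Rightarrow> 'f \<Rightarrow> 'g::real_normed_vector) \<Rightarrow> ('g \<Rightarrow>\<^sub>L 'x::real_normed_vector) set \<Rightarrow> ('g \<Rightarrow> 'x) set"
  where "gen_dual c V = dual_op c ` V"

text \<open>For \<open>\<phi> = \<phi>\<^sub>T\<close> one has \<open>\<phi> (c x y) = T (c x y)\<close>.\<close>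

definition gen_dual_norm ::
  "('e::real_normed_vector \<Rightarrow> 'f::real_normed_vector \<Rightarrow> 'g) \<Rightarrow>
   ('g \<Rightarrow> 'x::real_normed_vector) \<Rightarrow> real"
  where "gen_dual_norm c \<phi> = (SUP (x, y)\<in>cball 0 1 \<times> cball 0 1. norm (\<phi> (c x y)))"


definition left_lin ::
  "('e \<Rightarrow> 'f::real_normed_vector \<Rightarrow> 'g::real_normed_vector) \<Rightarrow> 'e \<Rightarrow> ('f \<Rightarrow>\<^sub>L 'g)"
  where "left_lin c x = Blinfun (c x)"

definition mult_op ::
  "('e::real_normed_vector \<Rightarrow> 'f::real_normed_vector \<Rightarrow> 'g::real_normed_vector) \<Rightarrow>
   ('g \<Rightarrow>\<^sub>L 'x::real_normed_vector) \<Rightarrow> ('e \<Rightarrow>\<^sub>L 'f \<Rightarrow>\<^sub>L 'x)"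
  where "mult_op c T = Blinfun (\<lambda>x. T o\<^sub>L left_lin c x)"

text \<open>This space carries the norm of \<open>'e \<Rightarrow>\<^sub>L 'f \<Rightarrow>\<^sub>L 'x\<close>.\<close>

definition mult_ops ::
  "('e::real_normed_vector \<Rightarrow> 'f::real_normed_vector \<Rightarrow> 'g::real_normed_vector) \<Rightarrow>
   ('g \<Rightarrow>\<^sub>L 'x::real_normed_vector) set \<Rightarrow> ('e \<Rightarrow>\<^sub>L 'f \<Rightarrow>\<^sub>L 'x) set"
  where "mult_ops c V = mult_op c ` V"

end

theory Submission
  imports Defs
begin

text \<open>An operator \<open>T\<close> agrees with \<open>\<phi>\<^sub>T\<close> on the product space, and both \<open>\<phi>\<^sub>T\<close> and \<open>S\<^sub>T\<close> are
  determined by the bilinear map \<open>T \<circ> c\<close>, so \<open>\<phi>\<^sub>T \<mapsto> S\<^sub>T\<close> is well defined and injective. The operator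
  norm of \<open>S\<^sub>T\<close> is the supremum of \<open>\<parallel>T (c x y)\<parallel>\<close> over the unit balls, which also is the operator norm
  of \<open>\<phi>\<^sub>T\<close>: elementary products \<open>c x y\<close> of unit vectors have \<open>\<pi>\<^sub>c\<close>-norm at most \<open>1\<close>, and conversely
  \<open>\<parallel>T w\<parallel> \<le> \<parallel>S\<^sub>T\<parallel> \<Sum> \<parallel>x\<^sub>i\<parallel> \<parallel>y\<^sub>i\<parallel>\<close> for each representation \<open>w = \<Sum> c x\<^sub>i y\<^sub>i\<close>.\<close>

section \<open>Operators on the product space\<close>

lemma sum_in_prod_space: "(\<Sum>i<n. c (x i) (y i)) \<in> prod_space c" for n :: nat
  unfolding prod_space_def by blast

lemma elementary_in_prod_space: "c x y \<in> prod_space c"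
  using sum_in_prod_space[of c "\<lambda>_. x" "\<lambda>_. y" 1] by simp

lemma prod_norm_elementary: "prod_norm c (c x y) \<le> norm x * norm y"
  using prod_norm_upper[of "c x y" c "\<lambda>_. x" "\<lambda>_. y" 1] by simp

text \<open>Additivity of \<open>T\<close> sends every representation of \<open>w\<close> to the
  same value \<open>T w\<close>, so the description in \<open>dual_op\<close> has exactly one
  witness. This is the independence of the representation.\<close>

lemma dual_op_eq_restrict: "dual_op c T = restrict (blinfun_apply T) (prod_space c)"
proof -
  have "(THE z. \<exists>(n::nat) x y. w = (\<Sum>i<n. c (x i) (y i)) \<and>
      z = (\<Sum>i<n. blinfun_apply T (c (x i) (y i)))) = blinfun_apply T w"
    if "w \<in> prod_space c" for w
  proof (rule the_equality)
    show "\<exists>(n::nat) x y. w = (\<Sum>i<n. c (x i) (y i)) \<and>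
        blinfun_apply T w = (\<Sum>i<n. blinfun_apply T (c (x i) (y i)))"
      using that unfolding prod_space_def mem_Collect_eq by (metis blinfun.sum_right)
  qed (auto simp: blinfun.sum_right)
  then show ?thesis
    unfolding dual_op_def by (rule restrict_ext)
qed

lemma dual_op_apply: "w \<in> prod_space c \<Longrightarrow> dual_op c T w = blinfun_apply T w"
  by (simp add: dual_op_eq_restrict)

text \<open>Every element of the product space is a finite sum of values of \<open>c\<close>, so
  these values decide equality. \<open>T\<close> and \<open>U\<close> may still differ elsewhere on
  the codomain of \<open>c\<close>.\<close>

lemma dual_op_eq_iff:
  "dual_op c T = dual_op c U \<longleftrightarrow> (\<forall>x y. blinfun_apply T (c x y) = blinfun_apply U (c x y))"
proof
  assume "dual_op c T = dual_op c U"
  then show "\<forall>x y. blinfun_apply T (c x y) = blinfun_apply U (c x y)"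
    by (metis dual_op_apply elementary_in_prod_space)
next
  assume "\<forall>x y. blinfun_apply T (c x y) = blinfun_apply U (c x y)"
  then show "dual_op c T = dual_op c U"
    unfolding dual_op_eq_restrict
    by (intro restrict_ext) (auto simp: prod_space_def blinfun.sum_right)
qed

lemma gen_dual_norm_dual_op:
  "gen_dual_norm c (dual_op c T) =
    (SUP (x, y)\<in>cball 0 1 \<times> cball 0 1. norm (blinfun_apply T (c x y)))"
  by (simp add: gen_dual_norm_def dual_op_apply elementary_in_prod_space)

section \<open>Multiplication operators\<close>

lemma blinfun_apply_left_lin:
  assumes "bounded_bilinear c"
  shows "blinfun_apply (left_lin c x) y = c x y"
  by (simp add: left_lin_def bounded_linear_Blinfun_apply
      bounded_bilinear.bounded_linear_right[OF assms])

text \<open>\<open>Blinfun\<close> returns the given function only if that function is bounded and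
  linear. A bound \<open>K\<close> for \<open>c\<close> also bounds \<open>left_lin c\<close>, and
  composition with \<open>T\<close> preserves bounded linearity.\<close>

lemma blinfun_apply_mult_op:
  assumes "bounded_bilinear c"
  shows "blinfun_apply (blinfun_apply (mult_op c T) x) y = blinfun_apply T (c x y)"
proof -
  interpret bounded_bilinear c by fact
  obtain K where K: "0 \<le> K" "\<And>x y. norm (c x y) \<le> norm x * norm y * K"
    using nonneg_bounded by blast
  have "bounded_linear (left_lin c)"
  proof (rule bounded_linear_intro[where K = K])
    show "norm (left_lin c x) \<le> norm x * K" for x
      using K by (intro norm_blinfun_bound) (auto simp: blinfun_apply_left_lin[OF assms] ac_simps)
  qed (auto intro!: blinfun_eqI
      simp: blinfun_apply_left_lin[OF assms] blinfun.add_left blinfun.scaleR_left add_left scaleR_left)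
  then have "bounded_linear (\<lambda>x. T o\<^sub>L left_lin c x)"
    by (rule bounded_linear_compose[OF bounded_bilinear.bounded_linear_right[OF
          bounded_bilinear_blinfun_compose]])
  then show ?thesis
    by (simp add: mult_op_def bounded_linear_Blinfun_apply blinfun_apply_left_lin[OF assms])
qed

lemma mult_op_eq_iff:
  assumes "bounded_bilinear c"
  shows "mult_op c T = mult_op c U \<longleftrightarrow>
    (\<forall>x y. blinfun_apply T (c x y) = blinfun_apply U (c x y))"
  by (metis (no_types, lifting) assms blinfun_apply_mult_op blinfun_eqI)

section \<open>Comparison of the norms\<close>

text \<open>Applying the operator norm inequality twice bounds the supremum. Conversely, homogeneity
  in both arguments reduces arbitrary vectors to vectors of the unit balls.\<close>

lemma SUP_norm_blinfun2:
  fixes S :: "'e::real_normed_vector \<Rightarrow>\<^sub>L 'f::real_normed_vector \<Rightarrow>\<^sub>L 'x::real_normed_vector"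
  shows "(SUP (x, y)\<in>cball 0 1 \<times> cball 0 1. norm (blinfun_apply (blinfun_apply S x) y)) = norm S"
proof (rule antisym)
  define N where "N = (SUP (x, y)\<in>cball 0 1 \<times> cball 0 1. norm (S x y))"
  have le: "norm (S x y) \<le> norm S * norm x * norm y" for x y
    by (rule order_trans[OF norm_blinfun mult_right_mono[OF norm_blinfun norm_ge_zero]])
  have unit: "norm (S x y) \<le> norm S" if "norm x \<le> 1" "norm y \<le> 1" for x y
  proof -
    have "norm S * (norm x * norm y) \<le> norm S * 1"
      using that by (intro mult_left_mono mult_le_one) auto
    then show ?thesis using le[of x y] by (simp add: mult.assoc)
  qed
  then show "(SUP (x, y)\<in>cball 0 1 \<times> cball 0 1. norm (S x y)) \<le> norm S"
    by (intro cSUP_least) auto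
  have "bdd_above ((\<lambda>(x, y). norm (S x y)) ` (cball 0 1 \<times> cball 0 1))"
    using unit by (intro bdd_aboveI[of _ "norm S"]) auto
  then have upper: "norm (S x y) \<le> N" if "norm x \<le> 1" "norm y \<le> 1" for x y
    unfolding N_def using that by (intro cSUP_upper2[where x = "(x, y)"]) auto
  have N: "0 \<le> N"
    using upper[of 0 0] by simp
  have "norm (S x y) \<le> N * norm x * norm y" for x y
  proof -
    \<comment> \<open>\<open>sgn\<close> normalizes a nonzero vector and sends 0 to 0, so the
      identity also covers zero arguments and both \<open>sgn x\<close> and \<open>sgn y\<close>
      stay in the unit balls.\<close>
    have "S x y = (norm x * norm y) *\<^sub>R S (sgn x) (sgn y)"
      by (cases "x = 0 \<or> y = 0")
        (auto simp: sgn_div_norm blinfun.scaleR_left blinfun.scaleR_right field_simps)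
    then have "norm (S x y) = (norm x * norm y) * norm (S (sgn x) (sgn y))"
      by simp
    also have "\<dots> \<le> (norm x * norm y) * N"
      by (intro mult_left_mono upper) (auto simp: norm_sgn)
    finally show ?thesis by (simp add: ac_simps)
  qed
  then show "norm S \<le> (SUP (x, y)\<in>cball 0 1 \<times> cball 0 1. norm (S x y))"
    unfolding N_def[symmetric] by (intro norm_blinfun_bound) (simp_all add: N)
qed

lemma gen_dual_norm_eq_norm_mult_op:
  assumes "bounded_bilinear c"
  shows "gen_dual_norm c (dual_op c T) = norm (mult_op c T)"
  unfolding gen_dual_norm_dual_op SUP_norm_blinfun2[symmetric]
  by (simp add: blinfun_apply_mult_op[OF assms])

lemma norm_dual_op_le:
  assumes c: "bounded_bilinear c" and w: "w \<in> prod_space c"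
  shows "norm (dual_op c T w) \<le> norm (mult_op c T) * prod_norm c w"
proof (cases "norm (mult_op c T) = 0")
  case True
  \<comment> \<open>The main case divides by the norm. If it vanishes, \<open>T\<close> and 0 agree
    on all values of \<open>c\<close>, so \<open>dual_op c T\<close> vanishes on the product
    space.\<close>
  then have "mult_op c T = mult_op c 0"
    by (auto intro!: blinfun_eqI simp: blinfun_apply_mult_op[OF c])
  then have "dual_op c T w = dual_op c 0 w"
    using dual_op_eq_iff mult_op_eq_iff[OF c] by metis
  with w True show ?thesis by (simp add: dual_op_apply)
next
  case False
  \<comment> \<open>After the division, the estimate is a lower bound common to all representations
    of \<open>w\<close>, hence a lower bound of their infimum.\<close>
  have "norm (blinfun_apply T w) / norm (mult_op c T) \<le> prod_norm c w"
  proof (rule prod_norm_greatest[OF w])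
    fix n :: nat and x y assume "w = (\<Sum>i<n. c (x i) (y i))"
    then have "norm (blinfun_apply T w) \<le> (\<Sum>i<n. norm (mult_op c T) * (norm (x i) * norm (y i)))"
      unfolding \<open>w = _\<close> blinfun.sum_right blinfun_apply_mult_op[OF c, symmetric]
      by (intro sum_norm_le)
        (use order_trans[OF norm_blinfun mult_right_mono[OF norm_blinfun norm_ge_zero]] in
          \<open>simp add: mult.assoc\<close>)
    with False show "norm (blinfun_apply T w) / norm (mult_op c T)
        \<le> (\<Sum>i<n. norm (x i) * norm (y i))"
      by (simp add: pos_divide_le_eq mult.commute flip: sum_distrib_left)
  qed
  with False w show ?thesis
    by (simp add: dual_op_apply pos_divide_le_eq mult.commute)
qed

lemma prod_opnorm_eq_norm_mult_op:
  assumes c: "bounded_bilinear c"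
  shows "prod_opnorm c (dual_op c T) = norm (mult_op c T)" (is "?P = _")
proof (rule antisym)
  let ?U = "{u \<in> prod_space c. prod_norm c u \<le> 1}"
  have elem: "c x y \<in> ?U" if "norm x \<le> 1" "norm y \<le> 1" for x y
    using that order_trans[OF prod_norm_elementary, of x y 1 c]
    by (simp add: mult_le_one elementary_in_prod_space)
  have le: "norm (dual_op c T u) \<le> norm (mult_op c T)" if "u \<in> ?U" for u
    using norm_dual_op_le[OF c, of u T] that mult_left_le[of "prod_norm c u" "norm (mult_op c T)"]
    by auto
  show "?P \<le> norm (mult_op c T)"
    \<comment> \<open>\<open>elem\<close> at zero makes the ball nonempty, which
      \<open>cSUP_least\<close> requires.\<close>
    unfolding prod_opnorm_def using elem[of 0 0] le by (intro cSUP_least) auto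
  have "bdd_above ((\<lambda>u. norm (dual_op c T u)) ` ?U)"
    using le by (intro bdd_aboveI[of _ "norm (mult_op c T)"]) blast
  then have "norm (dual_op c T (c x y)) \<le> ?P" if "norm x \<le> 1" "norm y \<le> 1" for x y
    unfolding prod_opnorm_def by (rule cSUP_upper2[OF _ elem]) (use that in auto)
  \<comment> \<open>The left side becomes the supremum over the products \<open>c x y\<close> with
    \<open>x\<close>, \<open>y\<close> in the unit balls, which form a subset of
    \<open>?U\<close>.\<close>
  then show "norm (mult_op c T) \<le> ?P"
    unfolding gen_dual_norm_eq_norm_mult_op[OF c, symmetric] gen_dual_norm_def
    by (intro cSUP_least) auto
qed

section \<open>Membership in the operator spaces\<close>

lemma dual_op_in_prod_ops:
  assumes c: "bounded_bilinear_over sE sF sG c" and T: "T \<in> bounded_ops sG sX"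
  shows "dual_op c T \<in> prod_ops sG sX c"
proof -
  have B: "bounded_bilinear c"
    using c by (simp add: bounded_bilinear_over_def)
  interpret T: Vector_Spaces.linear sG sX "blinfun_apply T"
    using T by (simp add: bounded_ops_def)
  note sub = subspace_prod_space[OF c]
  show ?thesis
    unfolding prod_ops_def
    using norm_dual_op_le[OF B, of _ T]
    by (auto simp: dual_op_eq_restrict T.vs1.subspace_add[OF sub] T.vs1.subspace_scale[OF sub]
        T.add T.scale intro!: exI[of _ "norm (mult_op c T)"])
qed

lemma mult_op_in_bounded_ops2:
  fixes c :: "'e::real_normed_vector \<Rightarrow> 'f::real_normed_vector \<Rightarrow> 'g::real_normed_vector"
  assumes X: "normed_space_over sX"
    and c: "bounded_bilinear_over sE sF sG c" and T: "T \<in> bounded_ops sG sX"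
  shows "mult_op c T \<in> bounded_ops2 sE sF sX"
proof -
  interpret X: normed_space_over sX by fact
  \<comment> \<open>This supplies the vector space axioms of the target when
    \<open>mult_op c T\<close> itself is shown to be linear.\<close>
  interpret LX: normed_space_over "scale_blinfun sX :: _ \<Rightarrow> ('f \<Rightarrow>\<^sub>L _) \<Rightarrow> _"
    by (rule X.normed_space_over_scale_blinfun)
  have B: "bounded_bilinear c"
    and right: "Vector_Spaces.linear sF sG (\<lambda>y. c x y)"
    and left: "Vector_Spaces.linear sE sG (\<lambda>x. c x y)" for x y
    using c by (auto simp: bounded_bilinear_over_def)
  interpret T: Vector_Spaces.linear sG sX "blinfun_apply T"
    using T by (simp add: bounded_ops_def)
  interpret R: Vector_Spaces.linear sF sG "\<lambda>y. c x y" for x by (rule right)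
  interpret L: Vector_Spaces.linear sE sG "\<lambda>x. c x y" for y by (rule left)
  have "Vector_Spaces.linear sF sX (blinfun_apply (blinfun_apply (mult_op c T) x))" for x
    by unfold_locales
      (simp_all add: blinfun_apply_mult_op[OF B] R.add R.scale T.add T.scale)
  moreover have "Vector_Spaces.linear sE (scale_blinfun sX) (blinfun_apply (mult_op c T))"
    by unfold_locales (auto intro!: blinfun_eqI simp: blinfun_apply_mult_op[OF B]
        X.blinfun_apply_scale_blinfun blinfun.add_left L.add L.scale T.add T.scale)
  ultimately show ?thesis
    by (auto simp: bounded_ops2_def bounded_ops_def)
qed

section \<open>Linear dependence on the operator\<close>

lemma dual_op_add: "prod_op_add c (dual_op c T) (dual_op c U) = dual_op c (T + U)"
  by (auto simp: prod_op_add_def dual_op_eq_restrict blinfun.add_left)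

lemma (in normed_space_over) dual_op_scale:
  "prod_op_scale s c k (dual_op c T) = dual_op c (scale_blinfun s k T)"
  by (auto simp: prod_op_scale_def dual_op_eq_restrict blinfun_apply_scale_blinfun)

lemma mult_op_add:
  assumes "bounded_bilinear c"
  shows "mult_op c (T + U) = mult_op c T + mult_op c U"
  by (auto intro!: blinfun_eqI simp: blinfun_apply_mult_op[OF assms] blinfun.add_left)

lemma (in normed_space_over) mult_op_scale:
  fixes c :: "'e::real_normed_vector \<Rightarrow> 'f::real_normed_vector \<Rightarrow> 'g::real_normed_vector"
  assumes "bounded_bilinear c"
  shows "mult_op c (scale_blinfun s k T) = scale_blinfun (scale_blinfun s) k (mult_op c T)"
proof -
  interpret L: normed_space_over "scale_blinfun s :: 'k \<Rightarrow> ('f \<Rightarrow>\<^sub>L 'a) \<Rightarrow> _"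
    by (rule normed_space_over_scale_blinfun)
  show ?thesis
    by (auto intro!: blinfun_eqI simp: blinfun_apply_mult_op[OF assms]
        blinfun_apply_scale_blinfun L.blinfun_apply_scale_blinfun)
qed

theorem theorem2p5:
  fixes sE :: "'k::real_normed_field \<Rightarrow> 'e::banach \<Rightarrow> 'e"
    and sF :: "'k \<Rightarrow> 'f::banach \<Rightarrow> 'f"
    and sG :: "'k \<Rightarrow> 'g::banach \<Rightarrow> 'g"
    and sX :: "'k \<Rightarrow> 'x::banach \<Rightarrow> 'x"
    and c :: "'e \<Rightarrow> 'f \<Rightarrow> 'g"
    and V :: "('g \<Rightarrow>\<^sub>L 'x) set"
  assumes "normed_space_over sE" and "normed_space_over sF"
    and "normed_space_over sG" and "normed_space_over sX"
    and "bounded_bilinear_over sE sF sG c"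
    and "V \<subseteq> bounded_ops sG sX"
    and "module.subspace (scale_blinfun sX) V"
    and "closed V"
  shows
    "(\<forall>T\<in>V. dual_op c T \<in> prod_ops sG sX c \<and>
       (\<forall>(n::nat) x y. dual_op c T (\<Sum>i<n. c (x i) (y i)) = (\<Sum>i<n. blinfun_apply T (c (x i) (y i)))) \<and>
       gen_dual_norm c (dual_op c T) =
         (SUP (x, y)\<in>cball 0 1 \<times> cball 0 1. norm (blinfun_apply T (c x y)))) \<and>
     (\<forall>T\<in>V. mult_op c T \<in> bounded_ops2 sE sF sX \<and>
       (\<forall>x y. blinfun_apply (blinfun_apply (mult_op c T) x) y = blinfun_apply T (c x y))) \<and>
     (gen_dual c V \<subseteq> prod_ops sG sX c) \<and>
     (\<forall>\<phi>\<in>gen_dual c V. prod_opnorm c \<phi> = gen_dual_norm c \<phi>) \<and>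
     (mult_ops c V \<subseteq> bounded_ops2 sE sF sX) \<and>
     (\<forall>\<phi>\<in>gen_dual c V. \<forall>\<psi>\<in>gen_dual c V. prod_op_add c \<phi> \<psi> \<in> gen_dual c V) \<and>
     (\<forall>k. \<forall>\<phi>\<in>gen_dual c V. prod_op_scale sX c k \<phi> \<in> gen_dual c V) \<and>
     (module.subspace (scale_blinfun (scale_blinfun sX)) (mult_ops c V)) \<and>
     (\<exists>\<Theta>. (\<forall>T\<in>V. \<Theta> (dual_op c T) = mult_op c T) \<and>
       bij_betw \<Theta> (gen_dual c V) (mult_ops c V) \<and>
       (\<forall>\<phi>\<in>gen_dual c V. \<forall>\<psi>\<in>gen_dual c V. \<Theta> (prod_op_add c \<phi> \<psi>) = \<Theta> \<phi> + \<Theta> \<psi>) \<and>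
       (\<forall>k. \<forall>\<phi>\<in>gen_dual c V. \<Theta> (prod_op_scale sX c k \<phi>) = scale_blinfun (scale_blinfun sX) k (\<Theta> \<phi>)) \<and>
       (\<forall>\<phi>\<in>gen_dual c V. norm (\<Theta> \<phi>) = gen_dual_norm c \<phi>))"
proof -
  interpret X: normed_space_over sX by fact
  interpret LX: normed_space_over "scale_blinfun sX :: 'k \<Rightarrow> ('f \<Rightarrow>\<^sub>L 'x) \<Rightarrow> _"
    by (rule X.normed_space_over_scale_blinfun)
  interpret LGX: normed_space_over "scale_blinfun sX :: 'k \<Rightarrow> ('g \<Rightarrow>\<^sub>L 'x) \<Rightarrow> _"
    by (rule X.normed_space_over_scale_blinfun)
  interpret LLX: normed_space_over
    "scale_blinfun (scale_blinfun sX) :: 'k \<Rightarrow> ('e \<Rightarrow>\<^sub>L 'f \<Rightarrow>\<^sub>L 'x) \<Rightarrow> _"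
    by (rule LX.normed_space_over_scale_blinfun)
  have B: "bounded_bilinear c"
    using assms(5) by (simp add: bounded_bilinear_over_def)
  have add: "T + U \<in> V" if "T \<in> V" "U \<in> V" for T U
    using LGX.subspace_add[OF assms(7)] that .
  have scale: "scale_blinfun sX k T \<in> V" if "T \<in> V" for k T
    using LGX.subspace_scale[OF assms(7)] that .
  have dual: "dual_op c T \<in> prod_ops sG sX c" if "T \<in> V" for T
    using dual_op_in_prod_ops[OF assms(5)] assms(6) that by blast
  have mult: "mult_op c T \<in> bounded_ops2 sE sF sX" if "T \<in> V" for T
    using mult_op_in_bounded_ops2[OF assms(4,5)] assms(6) that by blast
  have dual_add: "prod_op_add c (dual_op c T) (dual_op c U) \<in> gen_dual c V"
    if "T \<in> V" "U \<in> V" for T U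
    using that by (simp add: gen_dual_def dual_op_add add)
  have dual_scale: "prod_op_scale sX c k (dual_op c T) \<in> gen_dual c V" if "T \<in> V" for k T
    using that by (simp add: gen_dual_def X.dual_op_scale scale)
  have sub: "LLX.subspace (mult_ops c V)"
  proof (rule LLX.subspaceI)
    have "mult_op c 0 = 0"
      by (auto intro!: blinfun_eqI simp: blinfun_apply_mult_op[OF B])
    then show "0 \<in> mult_ops c V"
      unfolding mult_ops_def using LGX.subspace_0[OF assms(7)] by (metis image_eqI)
  next
    fix P Q assume "P \<in> mult_ops c V" "Q \<in> mult_ops c V"
    then show "P + Q \<in> mult_ops c V"
      by (auto simp: mult_ops_def add simp flip: mult_op_add[OF B])
  next
    fix k P assume "P \<in> mult_ops c V"
    then show "scale_blinfun (scale_blinfun sX) k P \<in> mult_ops c V"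
      by (auto simp: mult_ops_def scale simp flip: X.mult_op_scale[OF B])
  qed
  \<comment> \<open>An arbitrary preimage in \<open>V\<close> is chosen; it need not be the
    \<open>T\<close> from which \<phi> was formed.\<close>
  define \<Theta> where "\<Theta> \<phi> = mult_op c (inv_into V (dual_op c) \<phi>)" for \<phi>
  \<comment> \<open>Both sides say that \<open>T\<close> and \<open>U\<close> agree on all
    \<open>c x y\<close>. Left to right, \<Theta> does not depend on the chosen preimage; right to
    left, it is injective.\<close>
  have eq_iff: "dual_op c T = dual_op c U \<longleftrightarrow> mult_op c T = mult_op c U" for T U :: "'g \<Rightarrow>\<^sub>L 'x"
    by (simp add: dual_op_eq_iff mult_op_eq_iff[OF B])
  have \<Theta>: "\<Theta> (dual_op c T) = mult_op c T" if "T \<in> V" for T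
    unfolding \<Theta>_def eq_iff[symmetric] using that by (intro f_inv_into_f) simp
  have bij: "bij_betw \<Theta> (gen_dual c V) (mult_ops c V)"
    by (auto simp: bij_betw_def inj_on_def gen_dual_def mult_ops_def \<Theta> eq_iff image_image)
  have \<Theta>_add: "\<Theta> (prod_op_add c \<phi> \<psi>) = \<Theta> \<phi> + \<Theta> \<psi>"
    if "\<phi> \<in> gen_dual c V" "\<psi> \<in> gen_dual c V" for \<phi> \<psi>
    using that by (auto simp: gen_dual_def dual_op_add \<Theta> add mult_op_add[OF B])
  have \<Theta>_scale: "\<Theta> (prod_op_scale sX c k \<phi>) = scale_blinfun (scale_blinfun sX) k (\<Theta> \<phi>)"
    if "\<phi> \<in> gen_dual c V" for k \<phi>
    using that by (auto simp: gen_dual_def X.dual_op_scale \<Theta> scale X.mult_op_scale[OF B])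
  have \<Theta>_norm: "norm (\<Theta> \<phi>) = gen_dual_norm c \<phi>" if "\<phi> \<in> gen_dual c V" for \<phi>
    using that by (auto simp: gen_dual_def \<Theta> gen_dual_norm_eq_norm_mult_op[OF B])
  have opnorm: "prod_opnorm c \<phi> = gen_dual_norm c \<phi>" if "\<phi> \<in> gen_dual c V" for \<phi>
    using that by (auto simp: gen_dual_def gen_dual_norm_eq_norm_mult_op[OF B]
        prod_opnorm_eq_norm_mult_op[OF B])
  have dual_sum: "dual_op c T (\<Sum>i<n. c (x i) (y i)) = (\<Sum>i<n. blinfun_apply T (c (x i) (y i)))"
    for T :: "'g \<Rightarrow>\<^sub>L 'x" and n :: nat and x y
    by (simp add: dual_op_apply sum_in_prod_space blinfun.sum_right)
  show ?thesis
  proof (intro conjI)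
    show "\<exists>\<Theta>. (\<forall>T\<in>V. \<Theta> (dual_op c T) = mult_op c T) \<and>
       bij_betw \<Theta> (gen_dual c V) (mult_ops c V) \<and>
       (\<forall>\<phi>\<in>gen_dual c V. \<forall>\<psi>\<in>gen_dual c V. \<Theta> (prod_op_add c \<phi> \<psi>) = \<Theta> \<phi> + \<Theta> \<psi>) \<and>
       (\<forall>k. \<forall>\<phi>\<in>gen_dual c V. \<Theta> (prod_op_scale sX c k \<phi>) = scale_blinfun (scale_blinfun sX) k (\<Theta> \<phi>)) \<and>
       (\<forall>\<phi>\<in>gen_dual c V. norm (\<Theta> \<phi>) = gen_dual_norm c \<phi>)"
      using \<Theta> bij \<Theta>_add \<Theta>_scale \<Theta>_norm by blast
  qed (use dual dual_sum gen_dual_norm_dual_op mult blinfun_apply_mult_op[OF B] opnorm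
      dual_add dual_scale sub in \<open>auto simp: gen_dual_def mult_ops_def\<close>)
qed

end
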